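(* Let $m\ge 1$ be an integer, $J=\{0,1\}\subset\mathbb{Z}_4$, and $S=T=\prod_{j=1}^{2m}J\subset\mathbb{Z}_4^{2m}$. For $0\le i\le 2m$ let $B_{m,i}$ be the set of $x\in\mathbb{Z}_4^{2m}$ having exactly $2m-i$ coordinates equal to $0$ and exactly $i$ coordinates equal to $1$. Define $$S_0=\bigcup_{\substack{0\le i\le 2m\\ i\equiv 0,1 \bmod 4}}B_{m,i},\qquad S_1=\bigcup_{\substack{0\le i\le 2m\\ i\equiv 2,3\bmod 4}}B_{m,i},$$ which form a partition of $S$. Let $$S'=\{(0,x)\mid x\in S_0\}\cup\{(1,x)\mid x\in S_1\},\qquad T'=\{(0,x)\mid x\in T\}\cup\{(1,x)\mid x\in T^{(-1)}\}.$$ Then $S'$ and $T'$ form a primitive formally dual pair in $\mathbb{Z}_2\times\mathbb{Z}_4^{2m}$ (under the canonical isomorphism $(w,z)\mapsto\phi_{w,z}$). Moreover, the multiset $[\,[T'T'^{(-1)}]_g\mid g\in\mathbb{Z}_2\times\mathbb{Z}_4^{2m}]$ equals $$\Big[0\langle 2^{4m+1}-3^{2m+1}+2^{2m}\rangle,\ 2\langle (m+1)2^{2m+1}\rangle,\ 2^l\Big\langle 2^{2m-l+1}\Big(\tbinom{2m}{l-1}+\tbinom{2m}{l}\Big)\Big\rangle\ \Big|\ 2\le l\le 2m+1\Big].$$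
   Context: A subset of a finite abelian group $G$ is identified with the sum of its elements in the group ring $\mathbb{Z}[G]$. For $A=\sum_g a_g g\in\mathbb{Z}[G]$: $[A]_g=a_g$ is the coefficient of $g$; $A^{(-1)}=\sum_g a_g g^{-1}$; $\chi(A)=\sum_g a_g\chi(g)$ for a character $\chi$. Products such as $T'T'^{(-1)}$ are in the group ring. The group operation in $\mathbb{Z}_2\times\mathbb{Z}_4^{2m}$ is componentwise addition, so $T^{(-1)}=\{-t\mid t\in T\}$ and $[AA^{(-1)}]_g=\nu_A(g):=|\{(a_1,a_2)\in A\times A\mid g=a_1-a_2\}|$. Multiset notation: $[a_i\langle z_i\rangle\mid 1\le i\le t]$ is the multiset in which $a_i$ occurs $z_i$ times. $\binom{a}{b}=0$ if $b>a$. Formally dual pair: given an isomorphism $\Delta:G\to\widehat G$, $\Delta(y)=\chi_y$, subsets $S,T$ of $G$ form a formally dual pair under $\Delta$ if $|\chi_y(S)|^2=\frac{|S|^2}{|T|}\nu_T(y)$ for each $y\in G$. A subset of $G$ is primitive if it is not contained in a coset of a proper subgroup of $G$ and is not a union of cosets of a nontrivial subgroup of $G$; a formally dual pair is primitive if both subsets are primitive. Canonical isomorphism for $\mathbb{Z}_2\times\mathbb{Z}_4^n$: $(w,z)\mapsto\phi_{w,z}$ with $\phi_{w,z}((a,b))=(-1)^{wa}(\sqrt{-1})^{z\cdot b}$, where $z\cdot b=\sum_{i=1}^n z_ib_i$. *)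

theory Defs
  imports "HOL-Analysis.Analysis" "HOL-Library.Poly_Mapping" "HOL-Library.Multiset"
begin

(* Finite abelian groups are types of class {finite, ab_group_add}, written additively.
   The group ring Z[G] is the type of finitely supported functions from G to int, whose
   multiplication in HOL-Library.Poly_Mapping is convolution; the coefficient [A]_g is
   Poly_Mapping.lookup A g. *)

type_synonym 'a group_ring = "'a \<Rightarrow>\<^sub>0 int"

definition set_sum :: "'a::{finite,ab_group_add} set \<Rightarrow> 'a group_ring" where
  "set_sum A = (\<Sum>a\<in>A. Poly_Mapping.single a 1)"

definition ring_inv :: "'a::{finite,ab_group_add} group_ring \<Rightarrow> 'a group_ring" where
  "ring_inv A = (\<Sum>g\<in>UNIV. Poly_Mapping.single (- g) (Poly_Mapping.lookup A g))"

definition char_eval :: "('a::{finite,ab_group_add} \<Rightarrow> complex) \<Rightarrow> 'a group_ring \<Rightarrow> complex" where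
  "char_eval \<psi> A = (\<Sum>g\<in>UNIV. of_int (Poly_Mapping.lookup A g) * \<psi> g)"

definition diff_count :: "'a::{finite,ab_group_add} set \<Rightarrow> 'a \<Rightarrow> nat" where
  "diff_count A g = card {(a1, a2) \<in> A \<times> A. g = a1 - a2}"

(* The character group of G, as a set of functions with pointwise multiplication. *)
definition characters :: "('a::{finite,ab_group_add} \<Rightarrow> complex) set" where
  "characters = {\<psi>. (\<forall>x. \<psi> x \<noteq> 0) \<and> (\<forall>x y. \<psi> (x + y) = \<psi> x * \<psi> y)}"

definition dual_iso :: "('a::{finite,ab_group_add} \<Rightarrow> 'a \<Rightarrow> complex) \<Rightarrow> bool" where
  "dual_iso \<Delta> \<longleftrightarrow>
     bij_betw \<Delta> UNIV characters \<and> (\<forall>x y. \<Delta> (x + y) = (\<lambda>g. \<Delta> x g * \<Delta> y g))"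

(* For empty T the quotient by card T is 0 in HOL; the equation is only meaningful for
   nonempty T, which holds for every primitive T in a nontrivial group. *)
definition formally_dual_pair ::
    "('a::{finite,ab_group_add} \<Rightarrow> 'a \<Rightarrow> complex) \<Rightarrow> 'a set \<Rightarrow> 'a set \<Rightarrow> bool" where
  "formally_dual_pair \<Delta> S T \<longleftrightarrow>
     dual_iso \<Delta> \<and>
     (\<forall>y. (cmod (char_eval (\<Delta> y) (set_sum S)))\<^sup>2 =
          (real (card S))\<^sup>2 / real (card T) * real (diff_count T y))"

definition add_subgroup :: "'a::ab_group_add set \<Rightarrow> bool" where
  "add_subgroup H \<longleftrightarrow> 0 \<in> H \<and> (\<forall>x\<in>H. \<forall>y\<in>H. x + y \<in> H) \<and> (\<forall>x\<in>H. - x \<in> H)"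

definition coset :: "'a::ab_group_add \<Rightarrow> 'a set \<Rightarrow> 'a set" where
  "coset g H = (\<lambda>h. g + h) ` H"

definition primitive_subset :: "'a::{finite,ab_group_add} set \<Rightarrow> bool" where
  "primitive_subset A \<longleftrightarrow>
     \<not> (\<exists>H g. add_subgroup H \<and> H \<noteq> UNIV \<and> A \<subseteq> coset g H) \<and>
     \<not> (\<exists>H X. add_subgroup H \<and> H \<noteq> {0} \<and> A = (\<Union>g\<in>X. coset g H))"

definition primitive_formally_dual_pair ::
    "('a::{finite,ab_group_add} \<Rightarrow> 'a \<Rightarrow> complex) \<Rightarrow> 'a set \<Rightarrow> 'a set \<Rightarrow> bool" where
  "primitive_formally_dual_pair \<Delta> S T \<longleftrightarrow>
     formally_dual_pair \<Delta> S T \<and> primitive_subset S \<and> primitive_subset T"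

(* Z_k is the numeral type k, and Z_4^n is the vector type 4 ^ 'n with CARD('n) = n.
   Rep_bit0 maps a residue class of an even modulus k to its representative in {0..<k}. *)
definition canonical_iso :: "2 \<times> (4 ^ 'n::finite) \<Rightarrow> 2 \<times> (4 ^ 'n) \<Rightarrow> complex" where
  "canonical_iso = (\<lambda>(w, z) (a, b).
     (-1) powi Rep_bit0 (w * a) * \<i> powi Rep_bit0 (\<Sum>j\<in>UNIV. z $ j * b $ j))"

end

theory Submission
  imports Defs
begin

text \<open>
  Write \<open>n = 2 m\<close>. Both sets fibre over \<open>Z_2\<close>: \<open>T'\<close> consists of the cube
  \<open>{0, 1}^n\<close> over 0 and the cube \<open>{0, 3}^n\<close> over 1, while \<open>S'\<close> is the graph, over the cube
  \<open>{0, 1}^n\<close>, of a bit that depends only on the number \<open>k\<close> of ones. Everything then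
  factorises over the coordinates, because sums of products over a box are products of sums
  (\<open>sum_grid_prod\<close>).

  Difference counts. \<open>\<nu>_T'(0, x)\<close> is twice the product of the numbers 2, 1, 0, 1 attached to
  \<open>x_j = 0, 1, 2, 3\<close>, and \<open>\<nu>_T'(1, x)\<close> is the sum of the product of 1, 2, 1, 0 and the product
  of 1, 0, 1, 2 (\<open>diff_count_double_cube\<close>).

  Character sums. For \<open>w = 0\<close> the character sum of \<open>S'\<close> is \<open>\<Prod> (1 + i^z_j)\<close>. For \<open>w = 1\<close> the
  sign pattern \<open>+ + - -\<close> equals \<open>((1 - i) i^k + (1 + i) (-i)^k) / 2\<close>, which turns the sum into
  \<open>((1 - i) P + (1 + i) Q) / 2\<close> with \<open>P = \<Prod> (1 + i^(z_j + 1))\<close> and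
  \<open>Q = \<Prod> (1 + i^(z_j - 1))\<close>. Its squared modulus is \<open>(|P|^2 + |Q|^2) / 2\<close> as soon as
  \<open>P * cnj Q\<close> is real; each of the \<open>n\<close> factors of this product is purely imaginary, and \<open>n\<close> is even.
  Comparing the factors with those of the difference counts gives formal duality
  (\<open>formally_dual_pair_cubes\<close>).

  Primitivity. Differences of elements of either set yield the generators \<open>(1, 0)\<close> and
  \<open>(0, e_j)\<close>, and testing a period on a few elements forces it to be 0.

  The multiset. A nonzero value of \<open>\<nu>_T'\<close> is determined by the number of coordinates of \<open>x\<close>
  in a singleton, all other coordinates lying in a two-element set; such vectors are counted
  by \<open>card_grid_profile\<close>. For \<open>\<nu>_T'(1, x)\<close> the two supports meet in \<open>{0, 2}^n\<close>, where the
  value is 2, and inclusion-exclusion finishes the count.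
\<close>

section \<open>Residues modulo 2 and 4\<close>

lemma Z2_cases: "(x::2) = 0 \<or> x = 1"
  using exhaust_2[of x] by auto

lemma Z4_cases: "(x::4) = 0 \<or> x = 1 \<or> x = 2 \<or> x = 3"
  using exhaust_4[of x] by auto

lemma UNIV_Z2: "(UNIV :: 2 set) = {0, 1}"
  using Z2_cases by auto

text \<open>Numerals beyond the standard representatives that arise when the arithmetic of the two
  types is evaluated by cases.\<close>

lemma Z2_reduce: "(2::2) = 0" "(-1::2) = 1"
  by simp_all

lemma Z4_reduce:
  "(4::4) = 0" "(5::4) = 1" "(6::4) = 2" "(-1::4) = 3" "(-2::4) = 2" "(-3::4) = 1"
  by simp_all

section \<open>Characters\<close>

text \<open>The standard generators of the character groups of \<open>Z_2\<close> and \<open>Z_4\<close>.\<close>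

definition chi2 :: "2 \<Rightarrow> complex" where
  "chi2 u = (-1) powi Rep_bit0 u"

definition chi4 :: "4 \<Rightarrow> complex" where
  "chi4 u = \<i> powi Rep_bit0 u"

lemma chi2_simps: "chi2 0 = 1" "chi2 1 = -1"
  by (simp_all add: chi2_def bit0.Rep_0 bit0.Rep_1)

lemma chi4_simps: "chi4 0 = 1" "chi4 1 = \<i>" "chi4 2 = -1" "chi4 3 = -\<i>"
  by (simp_all add: chi4_def bit0.Rep_0 bit0.Rep_1 bit0.Rep_numeral power_int_def power3_eq_cube)

lemma chi2_add: "chi2 (u + v) = chi2 u * chi2 v"
  using Z2_cases[of u] Z2_cases[of v] by (elim disjE) (simp_all add: chi2_simps Z2_reduce)

lemma chi4_add: "chi4 (u + v) = chi4 u * chi4 v"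
  using Z4_cases[of u] Z4_cases[of v] by (elim disjE) (simp_all add: chi4_simps Z4_reduce)

lemma chi2_nonzero: "chi2 u \<noteq> 0"
  using Z2_cases[of u] by (auto simp: chi2_simps)

lemma chi4_nonzero: "chi4 u \<noteq> 0"
  using Z4_cases[of u] by (auto simp: chi4_simps)

lemma inj_chi2: "inj chi2"
proof (rule injI)
  fix u v assume "chi2 u = chi2 v"
  then show "u = v"
    using Z2_cases[of u] Z2_cases[of v] by (elim disjE) (simp_all add: chi2_simps)
qed

lemma inj_chi4: "inj chi4"
proof (rule injI)
  fix u v assume "chi4 u = chi4 v"
  then show "u = v"
    using Z4_cases[of u] Z4_cases[of v]
    by (elim disjE) (simp_all add: chi4_simps complex_eq_iff)
qed

lemma chi4_sum: "finite I \<Longrightarrow> chi4 (\<Sum>i\<in>I. f i) = (\<Prod>i\<in>I. chi4 (f i))"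
  by (induction I rule: finite_induct) (simp_all add: chi4_simps chi4_add)

lemma character_Z2:
  fixes \<eta> :: "2 \<Rightarrow> complex"
  assumes "\<eta> 0 = 1" and add: "\<And>c d. \<eta> (c + d) = \<eta> c * \<eta> d"
  obtains w where "\<And>c. \<eta> c = chi2 (w * c)"
proof -
  have "\<eta> 1 * \<eta> 1 = 1" using add[of 1 1] assms(1) by (simp add: Z2_reduce)
  then have "\<eta> 1 = 1 \<or> \<eta> 1 = -1" by (simp add: square_eq_1_iff)
  then obtain w where w: "\<eta> 1 = chi2 w" using chi2_simps by metis
  have "\<eta> c = chi2 (w * c)" for c
    using Z2_cases[of c] w assms(1) by (auto simp: chi2_simps)
  then show ?thesis using that by blast
qed

lemma character_Z4:
  fixes \<eta> :: "4 \<Rightarrow> complex"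
  assumes "\<eta> 0 = 1" and add: "\<And>c d. \<eta> (c + d) = \<eta> c * \<eta> d"
  obtains z where "\<And>c. \<eta> c = chi4 (z * c)"
proof -
  have 2: "\<eta> 2 = \<eta> 1 * \<eta> 1" using add[of 1 1] by simp
  have 3: "\<eta> 3 = \<eta> 1 * \<eta> 1 * \<eta> 1" using add[of 2 1] 2 by simp
  have "\<eta> 2 * \<eta> 2 = 1" using add[of 2 2] assms(1) by (simp add: Z4_reduce)
  then have "\<eta> 2 = 1 \<or> \<eta> 2 = -1" by (simp add: square_eq_1_iff)
  then have "(\<eta> 1)\<^sup>2 = 1 \<or> (\<eta> 1)\<^sup>2 = \<i>\<^sup>2" by (simp add: 2 power2_eq_square)
  then have "\<eta> 1 = 1 \<or> \<eta> 1 = -1 \<or> \<eta> 1 = \<i> \<or> \<eta> 1 = -\<i>"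
    by (metis power2_eq_iff power_one)
  then obtain z where z: "\<eta> 1 = chi4 z" using chi4_simps by metis
  have "\<eta> c = chi4 (z * c)" for c
    using Z4_cases[of c]
  proof (elim disjE)
    assume c: "c = 2"
    have "z * 2 = z + z" by (simp only: mult_2_right)
    then show ?thesis by (simp only: c 2 z chi4_add)
  next
    assume c: "c = 3"
    have "z * 3 = z + z + z"
    proof -
      have "z * (1 + 1 + 1) = z + z + z" by (simp only: distrib_left mult_1_right)
      then show ?thesis by simp
    qed
    then show ?thesis by (simp only: c 3 z chi4_add)
  qed (use z assms(1) in \<open>simp_all add: chi4_simps\<close>)
  then show ?thesis using that by blast
qed

text \<open>The factorisation over the coordinates on which all later computations rest.\<close>

lemma canonical_iso_eq:
  "canonical_iso (w, z) (a, b) = chi2 (w * a) * (\<Prod>j\<in>UNIV. chi4 (z $ j * b $ j))"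
proof -
  have "canonical_iso (w, z) (a, b) = chi2 (w * a) * chi4 (\<Sum>j\<in>UNIV. z $ j * b $ j)"
    by (simp add: canonical_iso_def chi2_def chi4_def)
  then show ?thesis by (simp add: chi4_sum)
qed

lemma vec_eq_sum_axis: "b = (\<Sum>j\<in>UNIV. axis j (b $ j))"
  for b :: "'a::comm_monoid_add ^ 'n"
  by (simp add: vec_eq_iff axis_def)

lemma canonical_iso_character: "canonical_iso y \<in> characters"
proof -
  obtain w z where y: "y = (w, z)" by fastforce
  show ?thesis
    unfolding characters_def y
    by (auto simp: canonical_iso_eq chi2_nonzero chi4_nonzero ring_distribs chi2_add chi4_add
        prod.distrib)
qed

lemma canonical_iso_surj:
  fixes \<psi> :: "2 \<times> (4 ^ 'n::finite) \<Rightarrow> complex"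
  assumes "\<psi> \<in> characters"
  obtains y where "\<psi> = canonical_iso y"
proof -
  have nz: "\<psi> x \<noteq> 0" and add: "\<psi> (x + y) = \<psi> x * \<psi> y" for x y
    using assms unfolding characters_def by blast+
  have zero: "\<psi> 0 = 1" using add[of 0 0] nz[of 0] by simp
  obtain w where w: "\<And>c. \<psi> (c, 0) = chi2 (w * c)"
  proof (rule character_Z2[of "\<lambda>c. \<psi> (c, 0)"])
    show "\<psi> (0, 0) = 1" using zero by (simp add: zero_prod_def)
    show "\<psi> (c + d, 0) = \<psi> (c, 0) * \<psi> (d, 0)" for c d
      using add[of "(c, 0)" "(d, 0)"] by simp
  qed blast
  have "\<exists>z. \<forall>c. \<psi> (0, axis j c) = chi4 (z * c)" for j
  proof -
    have *: "axis j (c + d) = axis j c + (axis j d :: 4 ^ 'n)" for c d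
      by (simp add: vec_eq_iff axis_def)
    have axis_0: "axis j 0 = (0 :: 4 ^ 'n)"
      by (simp add: vec_eq_iff axis_def)
    show ?thesis
    proof (rule character_Z4[of "\<lambda>c. \<psi> (0, axis j c)"])
      show "\<psi> (0, axis j 0) = 1" using zero by (simp add: axis_0 zero_prod_def)
      show "\<psi> (0, axis j (c + d)) = \<psi> (0, axis j c) * \<psi> (0, axis j d)" for c d
        using add[of "(0, axis j c)" "(0, axis j d)"] by (simp add: *)
    qed blast
  qed
  then obtain z where z: "\<psi> (0, axis j c) = chi4 (z j * c)" for j c
    by metis
  have sum: "\<psi> (0, \<Sum>i\<in>I. f i) = (\<Prod>i\<in>I. \<psi> (0, f i))" if "finite I"
    for f :: "'n \<Rightarrow> 4 ^ 'n" and I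
    using that
  proof (induction I rule: finite_induct)
    case empty
    then show ?case using zero by (simp add: zero_prod_def)
  next
    case (insert i I)
    then show ?case using add[of "(0, f i)" "(0, \<Sum>i\<in>I. f i)"] by simp
  qed
  have "\<psi> (a, b) = canonical_iso (w, \<chi> j. z j) (a, b)" for a b
  proof -
    have "\<psi> (a, b) = \<psi> (a, 0) * \<psi> (0, b)"
      using add[of "(a, 0)" "(0, b)"] by simp
    also have "\<psi> (0, b) = (\<Prod>j\<in>UNIV. \<psi> (0, axis j (b $ j)))"
      by (simp only: sum[OF finite, symmetric] vec_eq_sum_axis[symmetric])
    finally show ?thesis by (simp add: w z canonical_iso_eq)
  qed
  then have "\<psi> = canonical_iso (w, \<chi> j. z j)" by auto
  then show ?thesis using that by blast
qed

lemma inj_canonical_iso: "inj (canonical_iso :: 2 \<times> (4 ^ 'n::finite) \<Rightarrow> _)"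
proof (rule injI, clarify)
  fix w w' :: 2 and z z' :: "4 ^ 'n"
  assume eq: "canonical_iso (w, z) = canonical_iso (w', z')"
  from fun_cong[OF eq, of "(1, 0)"] have "w = w'"
    by (simp add: canonical_iso_eq chi4_simps inj_eq[OF inj_chi2])
  moreover have "z $ j = z' $ j" for j
  proof -
    have *: "chi4 (u $ i * axis j 1 $ i) = (if i = j then chi4 (u $ j) else 1)"
      for u :: "4 ^ 'n" and i
      by (simp add: axis_def chi4_simps)
    from fun_cong[OF eq, of "(0, axis j 1)"] show ?thesis
      by (simp add: canonical_iso_eq chi2_simps * inj_eq[OF inj_chi4])
  qed
  ultimately show "w = w' \<and> z = z'" by (simp add: vec_eq_iff)
qed

lemma dual_iso_canonical_iso: "dual_iso (canonical_iso :: 2 \<times> (4 ^ 'n::finite) \<Rightarrow> _)"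
  unfolding dual_iso_def bij_betw_def
proof (intro conjI allI)
  show "inj (canonical_iso :: 2 \<times> (4 ^ 'n) \<Rightarrow> _)" by (rule inj_canonical_iso)
  show "range (canonical_iso :: 2 \<times> (4 ^ 'n) \<Rightarrow> _) = characters"
  proof (intro equalityI subsetI)
    fix \<psi> :: "2 \<times> (4 ^ 'n) \<Rightarrow> complex"
    assume "\<psi> \<in> range canonical_iso"
    then show "\<psi> \<in> characters" using canonical_iso_character by blast
  next
    fix \<psi> :: "2 \<times> (4 ^ 'n) \<Rightarrow> complex"
    assume "\<psi> \<in> characters"
    then show "\<psi> \<in> range canonical_iso" using canonical_iso_surj by blast
  qed
  fix x y :: "2 \<times> (4 ^ 'n)"
  show "canonical_iso (x + y) = (\<lambda>g. canonical_iso x g * canonical_iso y g)"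
    by (cases x; cases y)
      (auto simp: fun_eq_iff canonical_iso_eq ring_distribs chi2_add chi4_add prod.distrib)
qed

section \<open>Sets in the group ring\<close>

lemma lookup_set_sum: "Poly_Mapping.lookup (set_sum A) g = of_bool (g \<in> A)"
proof -
  have "Poly_Mapping.lookup (set_sum A) g = (\<Sum>a\<in>A. if a = g then 1 else 0)"
    unfolding set_sum_def lookup_sum by (intro sum.cong) (auto simp: lookup_single when_def)
  then show ?thesis by simp
qed

lemma char_eval_set_sum: "char_eval \<psi> (set_sum A) = (\<Sum>a\<in>A. \<psi> a)"
proof -
  have "char_eval \<psi> (set_sum A) = (\<Sum>g\<in>UNIV. if g \<in> A then \<psi> g else 0)"
    unfolding char_eval_def by (intro sum.cong) (auto simp: lookup_set_sum)
  then show ?thesis by (simp flip: sum.inter_restrict)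
qed

lemma diff_count_eq: "diff_count A g = card {t \<in> A. t - g \<in> A}"
proof -
  have "bij_betw (\<lambda>t. (t, t - g)) {t \<in> A. t - g \<in> A} {(a1, a2) \<in> A \<times> A. g = a1 - a2}"
    by (rule bij_betw_byWitness[where f' = fst]) auto
  then show ?thesis by (simp add: diff_count_def bij_betw_same_card)
qed

lemma lookup_set_sum_mult_ring_inv:
  "Poly_Mapping.lookup (set_sum A * ring_inv (set_sum A)) g = int (diff_count A g)"
proof -
  have "ring_inv (set_sum A) = (\<Sum>b\<in>UNIV. if b \<in> A then Poly_Mapping.single (- b) 1 else 0)"
    unfolding ring_inv_def by (intro sum.cong) (auto simp: lookup_set_sum)
  also have "\<dots> = (\<Sum>b\<in>A. Poly_Mapping.single (- b) 1)"
    by (simp flip: sum.inter_restrict)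
  finally have "set_sum A * ring_inv (set_sum A) = (\<Sum>a\<in>A. \<Sum>b\<in>A. Poly_Mapping.single (a - b) 1)"
    by (simp add: set_sum_def sum_product mult_single)
  then have "Poly_Mapping.lookup (set_sum A * ring_inv (set_sum A)) g =
      (\<Sum>a\<in>A. \<Sum>b\<in>A. of_bool (g = a - b))"
    by (simp add: lookup_sum lookup_single when_def of_bool_def)
  also have "\<dots> = (\<Sum>a\<in>A. of_bool (a - g \<in> A))"
  proof (rule sum.cong)
    fix a
    have "(\<Sum>b\<in>A. of_bool (g = a - b)) = (\<Sum>b\<in>A. if b = a - g then 1 else 0 :: int)"
      by (intro sum.cong) (auto simp: algebra_simps)
    then show "(\<Sum>b\<in>A. of_bool (g = a - b)) = (of_bool (a - g \<in> A) :: int)" by simp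
  qed simp
  also have "\<dots> = int (diff_count A g)"
    by (simp add: diff_count_eq Int_def)
  finally show ?thesis .
qed

section \<open>Boxes\<close>

text \<open>The box \<open>\<Prod>j. A j\<close>, as a set of vectors.\<close>

definition grid :: "('n \<Rightarrow> 'a set) \<Rightarrow> ('a ^ 'n) set" where
  "grid A = {x. \<forall>j. x $ j \<in> A j}"

lemma sum_grid_prod:
  fixes f :: "'n::finite \<Rightarrow> 'a \<Rightarrow> 'b::comm_semiring_1"
  assumes "\<And>j. finite (A j)"
  shows "(\<Sum>x\<in>grid A. \<Prod>j\<in>UNIV. f j (x $ j)) = (\<Prod>j\<in>UNIV. \<Sum>c\<in>A j. f j c)"
proof -
  have "(\<Prod>j\<in>UNIV. \<Sum>c\<in>A j. f j c) = (\<Sum>g\<in>Pi\<^sub>E UNIV A. \<Prod>j\<in>UNIV. f j (g j))"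
    using assms by (intro prod_sum_PiE) auto
  also have "\<dots> = (\<Sum>x\<in>grid A. \<Prod>j\<in>UNIV. f j (x $ j))"
    by (rule sum.reindex_bij_witness[where i = vec_nth and j = vec_lambda])
      (auto simp: grid_def PiE_def Pi_def)
  finally show ?thesis by simp
qed

lemma card_grid:
  fixes A :: "'n::finite \<Rightarrow> 'a set"
  assumes "\<And>j. finite (A j)"
  shows "card (grid A) = (\<Prod>j\<in>UNIV. card (A j))"
  using sum_grid_prod[OF assms, where f = "\<lambda>_ _. 1 :: nat"] by simp

lemma card_grid_const: "card (grid (\<lambda>_. A) :: ('a::finite ^ 'n::finite) set) = card A ^ CARD('n)"
  by (simp add: card_grid)

text \<open>Classify the vectors by the set of coordinates that lie in \<open>A\<close>: there are
  \<open>n choose k\<close> such sets of size \<open>k\<close>, and each determines a box.\<close>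

lemma card_grid_profile:
  fixes A B :: "'a::finite set"
  assumes "A \<inter> B = {}"
  shows "card {x \<in> grid (\<lambda>_::'n::finite. A \<union> B). card {j. x $ j \<in> A} = k} =
    (CARD('n) choose k) * (card A ^ k * card B ^ (CARD('n) - k))"
proof -
  let ?G = "\<lambda>I. grid (\<lambda>j::'n. if j \<in> I then A else B)"
  let ?N = "{I::'n set. card I = k}"
  have eq: "{x \<in> grid (\<lambda>_::'n. A \<union> B). card {j. x $ j \<in> A} = k} = (\<Union>I\<in>?N. ?G I)"
  proof (intro equalityI subsetI)
    fix x assume x: "x \<in> {x \<in> grid (\<lambda>_::'n. A \<union> B). card {j. x $ j \<in> A} = k}"
    show "x \<in> (\<Union>I\<in>?N. ?G I)"
    proof (rule UN_I)
      show "{j. x $ j \<in> A} \<in> ?N" using x by simp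
      show "x \<in> ?G {j. x $ j \<in> A}" using x by (auto simp: grid_def)
    qed
  next
    fix x assume "x \<in> (\<Union>I\<in>?N. ?G I)"
    then obtain I where I: "card I = k" "x \<in> ?G I" by (elim UN_E) simp
    have in_iff: "x $ j \<in> (if j \<in> I then A else B)" for j
      using I(2) by (simp add: grid_def)
    have "x $ j \<in> A \<longleftrightarrow> j \<in> I" "x $ j \<in> A \<union> B" for j
      using in_iff[of j] assms by (auto split: if_splits)
    then show "x \<in> {x \<in> grid (\<lambda>_::'n. A \<union> B). card {j. x $ j \<in> A} = k}"
      using I(1) by (simp add: grid_def)
  qed
  have disj: "?G I \<inter> ?G I' = {}" if "I \<noteq> I'" for I I'
  proof -
    from that obtain j where "j \<in> I \<longleftrightarrow> j \<notin> I'" by blast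
    have False if "x \<in> ?G I" "x \<in> ?G I'" for x
    proof -
      have "x $ j \<in> (if j \<in> I then A else B)" "x $ j \<in> (if j \<in> I' then A else B)"
        using that by (simp_all add: grid_def)
      with \<open>j \<in> I \<longleftrightarrow> j \<notin> I'\<close> assms show False by (auto split: if_splits)
    qed
    then show ?thesis by (intro Int_emptyI)
  qed
  have card_G: "card (?G I) = card A ^ k * card B ^ (CARD('n) - k)" if "I \<in> ?N" for I
  proof -
    have "card (?G I) = (\<Prod>j\<in>UNIV. if j \<in> I then card A else card B)"
      by (subst card_grid) (auto intro!: prod.cong)
    also have "\<dots> = card A ^ card I * card B ^ card (- I)"
      by (simp add: prod.If_cases)
    also have "card (- I) = CARD('n) - card I"
      by (simp only: Compl_eq_Diff_UNIV card_Diff_subset[OF finite subset_UNIV])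
    finally show ?thesis using that by simp
  qed
  have "card (\<Union>I\<in>?N. ?G I) = (\<Sum>I\<in>?N. card (?G I))"
    using disj by (intro card_UN_disjoint) simp_all
  also have "\<dots> = card ?N * (card A ^ k * card B ^ (CARD('n) - k))"
    using card_G by simp
  also have "card ?N = (CARD('n) choose k)"
    using n_subsets[of "UNIV :: 'n set" k] by simp
  finally show ?thesis by (simp add: eq)
qed

text \<open>Image multisets are written as sums of singletons, so that the laws of sums over sets
  apply to them.\<close>

lemma sum_single_const: "finite A \<Longrightarrow> (\<Sum>x\<in>A. {#c#}) = replicate_mset (card A) c"
  by (induction A rule: finite_induct) simp_all

lemma sum_single_grid_profile:
  fixes A B :: "'a::finite set" and f :: "nat \<Rightarrow> 'b"
  assumes "A \<inter> B = {}"
  shows "(\<Sum>x\<in>grid (\<lambda>_::'n::finite. A \<union> B). {#f (card {j. x $ j \<in> A})#}) =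
    (\<Sum>k\<le>CARD('n).
      replicate_mset ((CARD('n) choose k) * (card A ^ k * card B ^ (CARD('n) - k))) (f k))"
    (is "sum ?h ?G = _")
proof -
  have "sum ?h ?G = (\<Sum>k\<le>CARD('n). \<Sum>x | x \<in> ?G \<and> card {j. x $ j \<in> A} = k. ?h x)"
    by (rule sum.group[symmetric]) (auto intro: card_mono)
  also have "\<dots> = (\<Sum>k\<le>CARD('n). \<Sum>x | x \<in> ?G \<and> card {j. x $ j \<in> A} = k. {#f k#})"
    by (intro sum.cong) auto
  also have "\<dots> = (\<Sum>k\<le>CARD('n). replicate_mset
      ((CARD('n) choose k) * (card A ^ k * card B ^ (CARD('n) - k))) (f k))"
    by (simp add: sum_single_const card_grid_profile[OF assms])
  finally show ?thesis .
qed

lemma prod_power_two: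
  fixes x :: "'a ^ 'n::finite"
  assumes "A \<inter> B = {}"
  shows "(\<Prod>j\<in>UNIV. if x $ j \<in> A then 2 else if x $ j \<in> B then 1 else 0 :: nat) =
    (if x \<in> grid (\<lambda>_. A \<union> B) then 2 ^ card {j. x $ j \<in> A} else 0)"
proof (cases "x \<in> grid (\<lambda>_. A \<union> B)")
  case True
  then have "(\<Prod>j\<in>UNIV. if x $ j \<in> A then 2 else if x $ j \<in> B then 1 else 0 :: nat) =
      (\<Prod>j\<in>UNIV. if x $ j \<in> A then 2 else 1)"
    by (intro prod.cong) (auto simp: grid_def)
  with True show ?thesis by (simp add: prod.If_cases)
next
  case False
  then obtain j where "x $ j \<notin> A \<union> B" by (auto simp: grid_def)
  then have "(\<Prod>j\<in>UNIV. if x $ j \<in> A then 2 else if x $ j \<in> B then 1 else 0 :: nat) = 0"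
    by (intro prod_zero) auto
  with False show ?thesis by simp
qed


section \<open>The two sets and their fibres\<close>

text \<open>The set \<open>fibre a\<close> is \<open>J\<close> for \<open>a = 0\<close> and \<open>-J\<close> for \<open>a = 1\<close>, where \<open>J = {0, 1}\<close>;
  \<open>double_cube\<close> is then the set \<open>T'\<close>.\<close>

definition fibre :: "2 \<Rightarrow> 4 set" where
  "fibre a = (if a = 0 then {0, 1} else {0, 3})"

definition double_cube :: "(2 \<times> (4 ^ 'n::finite)) set" where
  "double_cube = {(a, x). x \<in> grid (\<lambda>_. fibre a)}"

text \<open>The number of coordinates equal to 1, which on \<open>{0, 1}^n\<close> is the number of nonzero
  coordinates.\<close>

definition weight :: "4 ^ 'n::finite \<Rightarrow> nat" where
  "weight x = card {j. x $ j = 1}"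

text \<open>The \<open>Z_2\<close>-coordinate that \<open>S'\<close> assigns to the vectors of weight \<open>k\<close>, and \<open>S'\<close> itself
  as a graph over the cube.\<close>

definition lift_bit :: "nat \<Rightarrow> 2" where
  "lift_bit k = (if k mod 4 \<in> {0, 1} then 0 else 1)"

definition lifted_cube :: "(2 \<times> (4 ^ 'n::finite)) set" where
  "lifted_cube = (\<lambda>x. (lift_bit (weight x), x)) ` grid (\<lambda>_. {0, 1})"

lemma fibre_0_mem: "c \<in> fibre 0 \<longleftrightarrow> c = 0 \<or> c = 1"
  and fibre_1_mem: "c \<in> fibre 1 \<longleftrightarrow> c = 0 \<or> c = 3"
  by (auto simp: fibre_def)

lemma zero_in_fibre: "0 \<in> fibre a"
  by (simp add: fibre_def)

lemma card_lifted_cube: "card (lifted_cube :: (2 \<times> (4 ^ 'n::finite)) set) = 2 ^ CARD('n)"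
proof -
  have "inj_on (\<lambda>x. (lift_bit (weight x), x)) (grid (\<lambda>_. {0, 1}) :: (4 ^ 'n) set)"
    by (rule inj_onI) simp
  then show ?thesis by (simp add: lifted_cube_def card_image card_grid_const numeral_2_eq_2)
qed

lemma card_double_cube: "card (double_cube :: (2 \<times> (4 ^ 'n::finite)) set) = 2 ^ (CARD('n) + 1)"
proof -
  have eq: "double_cube = (SIGMA a:UNIV. grid (\<lambda>_::'n. fibre a))"
    by (auto simp: double_cube_def)
  have "card (double_cube :: (2 \<times> (4 ^ 'n)) set) =
      (\<Sum>a\<in>UNIV. card (grid (\<lambda>_::'n. fibre a)))"
    unfolding eq by (rule card_SigmaI) simp_all
  moreover have "card (fibre a) = 2" for a by (simp add: fibre_def)
  ultimately show ?thesis by (simp add: card_grid_const)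
qed

section \<open>Difference counts of the doubled cube\<close>

text \<open>The contribution of one coordinate to the difference count at \<open>(a, x)\<close>: the number of
  differences equal to \<open>u\<close>, with minuend in the fibre over \<open>c\<close> and hence subtrahend in the fibre
  over \<open>c - a\<close>.\<close>

definition fibre_count :: "2 \<Rightarrow> 2 \<Rightarrow> 4 \<Rightarrow> nat" where
  "fibre_count c a u = card {t \<in> fibre c. t - u \<in> fibre (c - a)}"

lemma card_filter_pair:
  "a \<noteq> b \<Longrightarrow> card {t \<in> {a, b}. P t} = of_bool (P a) + of_bool (P b)"
proof -
  assume "a \<noteq> b"
  have "{t \<in> {a, b}. P t} = (if P a then {a} else {}) \<union> (if P b then {b} else {})" by auto
  with \<open>a \<noteq> b\<close> show ?thesis by simp
qed

lemma fibre_count_simps: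
  "fibre_count 0 0 u = (if u \<in> {0} then 2 else if u \<in> {1, 3} then 1 else 0)"
  "fibre_count 1 0 u = (if u \<in> {0} then 2 else if u \<in> {1, 3} then 1 else 0)"
  "fibre_count 0 1 u = (if u \<in> {1} then 2 else if u \<in> {0, 2} then 1 else 0)"
  "fibre_count 1 1 u = (if u \<in> {3} then 2 else if u \<in> {0, 2} then 1 else 0)"
proof -
  have 0: "card {t \<in> fibre 0. P t} = of_bool (P 0) + of_bool (P 1)"
    and 1: "card {t \<in> fibre 1. P t} = of_bool (P 0) + of_bool (P 3)" for P
    by (simp_all only: fibre_def if_True if_False one_neq_zero refl)
      (rule card_filter_pair, simp)+
  show "fibre_count 0 0 u = (if u \<in> {0} then 2 else if u \<in> {1, 3} then 1 else 0)"
    using Z4_cases[of u] unfolding fibre_count_def 0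
    by (elim disjE) (simp_all add: fibre_0_mem fibre_1_mem Z4_reduce)
  show "fibre_count 1 0 u = (if u \<in> {0} then 2 else if u \<in> {1, 3} then 1 else 0)"
    using Z4_cases[of u] unfolding fibre_count_def 1
    by (elim disjE) (simp_all add: fibre_0_mem fibre_1_mem Z4_reduce)
  show "fibre_count 0 1 u = (if u \<in> {1} then 2 else if u \<in> {0, 2} then 1 else 0)"
    using Z4_cases[of u] unfolding fibre_count_def 0
    by (elim disjE) (simp_all add: fibre_0_mem fibre_1_mem Z4_reduce Z2_reduce)
  show "fibre_count 1 1 u = (if u \<in> {3} then 2 else if u \<in> {0, 2} then 1 else 0)"
    using Z4_cases[of u] unfolding fibre_count_def 1
    by (elim disjE) (simp_all add: fibre_0_mem fibre_1_mem Z4_reduce)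
qed

lemma diff_count_double_cube:
  fixes x :: "4 ^ 'n::finite"
  shows "diff_count double_cube (a, x) =
    (\<Prod>j\<in>UNIV. fibre_count 0 a (x $ j)) + (\<Prod>j\<in>UNIV. fibre_count 1 a (x $ j))"
proof -
  have "{t \<in> double_cube. t - (a, x) \<in> double_cube} =
      (SIGMA c:UNIV. grid (\<lambda>j. {t \<in> fibre c. t - x $ j \<in> fibre (c - a)}))"
    by (auto simp: double_cube_def grid_def)
  then show ?thesis
    by (simp add: diff_count_eq card_SigmaI card_grid fibre_count_def UNIV_Z2)
qed

lemma diff_count_double_cube_0:
  fixes x :: "4 ^ 'n::finite"
  shows "diff_count double_cube (0, x) =
    (if x \<in> grid (\<lambda>_. {0} \<union> {1, 3}) then 2 ^ (card {j. x $ j \<in> {0}} + 1) else 0)"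
proof -
  have "diff_count double_cube (0, x) =
      2 * (\<Prod>j\<in>UNIV. if x $ j \<in> {0} then 2 else if x $ j \<in> {1, 3} then 1 else 0)"
    unfolding diff_count_double_cube fibre_count_simps by simp
  also have "\<dots> = 2 * (if x \<in> grid (\<lambda>_. {0} \<union> {1, 3}) then 2 ^ card {j. x $ j \<in> {0}} else 0)"
    by (subst prod_power_two) simp_all
  finally show ?thesis by simp
qed

lemma diff_count_double_cube_1:
  fixes x :: "4 ^ 'n::finite"
  shows "diff_count double_cube (1, x) =
    (if x \<in> grid (\<lambda>_. {1} \<union> {0, 2}) then 2 ^ card {j. x $ j \<in> {1}} else 0) +
    (if x \<in> grid (\<lambda>_. {3} \<union> {0, 2}) then 2 ^ card {j. x $ j \<in> {3}} else 0)"
  unfolding diff_count_double_cube fibre_count_simps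
  by (subst (1 2) prod_power_two) simp_all

section \<open>Character sums of the lifted cube\<close>

text \<open>The sign pattern \<open>+ + - -\<close> as a combination of two characters of \<open>k\<close>. The powers of
  \<open>i\<close> and \<open>-i\<close> with exponent the weight are products over the coordinates, so the
  sign can be absorbed into the character sum.\<close>

lemma chi2_lift_bit: "chi2 (lift_bit k) = ((1 - \<i>) * \<i> ^ k + (1 + \<i>) * (-\<i>) ^ k) / 2"
proof -
  have "k = 4 * (k div 4) + k mod 4" by simp
  moreover have "\<i> ^ 4 = 1" "(-\<i>) ^ 4 = 1" by (simp_all add: power4_eq_xxxx)
  ultimately have red: "\<i> ^ k = \<i> ^ (k mod 4)" "(-\<i>) ^ k = (-\<i>) ^ (k mod 4)"
    by (metis mult_1 power_add power_mult power_one)+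
  have "k mod 4 < 4" by simp
  then have "k mod 4 = 0 \<or> k mod 4 = 1 \<or> k mod 4 = 2 \<or> k mod 4 = 3" by linarith
  then show ?thesis unfolding red lift_bit_def
    by (elim disjE) (simp_all add: chi2_simps power2_eq_square power3_eq_cube algebra_simps)
qed

lemma power_weight:
  assumes "x \<in> grid (\<lambda>_. {0, 1})"
  shows "\<i> ^ weight x = (\<Prod>j\<in>UNIV. chi4 (x $ j))"
    and "(-\<i>) ^ weight x = (\<Prod>j\<in>UNIV. chi4 (- x $ j))"
proof -
  have mem: "x $ j = 0 \<or> x $ j = 1" for j using assms by (simp add: grid_def)
  have "(\<Prod>j\<in>UNIV. chi4 (x $ j)) = (\<Prod>j\<in>UNIV. if x $ j = 1 then \<i> else 1)"
  proof (rule prod.cong)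
    show "chi4 (x $ j) = (if x $ j = 1 then \<i> else 1)" for j
      using mem[of j] by (auto simp: chi4_simps)
  qed simp
  then show "\<i> ^ weight x = (\<Prod>j\<in>UNIV. chi4 (x $ j))"
    by (simp add: prod.If_cases weight_def)
  have "(\<Prod>j\<in>UNIV. chi4 (- x $ j)) = (\<Prod>j\<in>UNIV. if x $ j = 1 then -\<i> else 1)"
  proof (rule prod.cong)
    show "chi4 (- x $ j) = (if x $ j = 1 then -\<i> else 1)" for j
      using mem[of j] by (auto simp: chi4_simps Z4_reduce)
  qed simp
  then show "(-\<i>) ^ weight x = (\<Prod>j\<in>UNIV. chi4 (- x $ j))"
    by (simp add: prod.If_cases weight_def)
qed

lemma char_eval_lifted_cube:
  fixes z :: "4 ^ 'n::finite"
  shows "char_eval (canonical_iso (w, z)) (set_sum lifted_cube) =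
    (\<Sum>x\<in>grid (\<lambda>_. {0, 1}). chi2 (w * lift_bit (weight x)) * (\<Prod>j\<in>UNIV. chi4 (z $ j * x $ j)))"
proof -
  have "inj_on (\<lambda>x. (lift_bit (weight x), x)) (grid (\<lambda>_::'n. {0, 1}))"
    by (rule inj_onI) simp
  then show ?thesis
    by (simp add: char_eval_set_sum lifted_cube_def sum.reindex canonical_iso_eq)
qed

lemma char_eval_lifted_cube_0:
  "char_eval (canonical_iso (0, z)) (set_sum lifted_cube) = (\<Prod>j\<in>UNIV. 1 + chi4 (z $ j))"
proof -
  have "char_eval (canonical_iso (0, z)) (set_sum lifted_cube) =
      (\<Sum>x\<in>grid (\<lambda>_. {0, 1}). \<Prod>j\<in>UNIV. chi4 (z $ j * x $ j))"
    by (simp add: char_eval_lifted_cube chi2_simps)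
  also have "\<dots> = (\<Prod>j\<in>UNIV. \<Sum>c\<in>{0, 1}. chi4 (z $ j * c))"
    by (rule sum_grid_prod) simp
  finally show ?thesis by (simp add: chi4_simps)
qed

lemma char_eval_lifted_cube_1:
  fixes z :: "4 ^ 'n::finite"
  shows "char_eval (canonical_iso (1, z)) (set_sum lifted_cube) =
    ((1 - \<i>) * (\<Prod>j\<in>UNIV. 1 + chi4 (z $ j + 1)) +
     (1 + \<i>) * (\<Prod>j\<in>UNIV. 1 + chi4 (z $ j - 1))) / 2"
proof -
  let ?G = "grid (\<lambda>_::'n. {0, 1 :: 4})"
  have "char_eval (canonical_iso (1, z)) (set_sum lifted_cube) =
      (\<Sum>x\<in>?G. ((1 - \<i>) * (\<Prod>j\<in>UNIV. chi4 (z $ j * x $ j + x $ j)) +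
        (1 + \<i>) * (\<Prod>j\<in>UNIV. chi4 (z $ j * x $ j - x $ j))) / 2)"
    unfolding char_eval_lifted_cube
  proof (rule sum.cong)
    fix x assume "x \<in> ?G"
    note pw = power_weight[OF this]
    show "chi2 (1 * lift_bit (weight x)) * (\<Prod>j\<in>UNIV. chi4 (z $ j * x $ j)) =
      ((1 - \<i>) * (\<Prod>j\<in>UNIV. chi4 (z $ j * x $ j + x $ j)) +
        (1 + \<i>) * (\<Prod>j\<in>UNIV. chi4 (z $ j * x $ j - x $ j))) / 2"
    proof -
      have "(\<Prod>j\<in>UNIV. chi4 (z $ j * x $ j + x $ j)) =
          (\<Prod>j\<in>UNIV. chi4 (z $ j * x $ j)) * \<i> ^ weight x"
        by (simp only: pw chi4_add prod.distrib)
      moreover have "(\<Prod>j\<in>UNIV. chi4 (z $ j * x $ j - x $ j)) =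
          (\<Prod>j\<in>UNIV. chi4 (z $ j * x $ j)) * (-\<i>) ^ weight x"
        by (simp only: pw diff_conv_add_uminus chi4_add prod.distrib)
      ultimately show ?thesis by (simp add: chi2_lift_bit algebra_simps)
    qed
  qed simp
  also have "\<dots> = ((1 - \<i>) * (\<Sum>x\<in>?G. \<Prod>j\<in>UNIV. chi4 (z $ j * x $ j + x $ j)) +
        (1 + \<i>) * (\<Sum>x\<in>?G. \<Prod>j\<in>UNIV. chi4 (z $ j * x $ j - x $ j))) / 2"
    by (simp add: sum.distrib sum_distrib_left flip: sum_divide_distrib)
  also have "(\<Sum>x\<in>?G. \<Prod>j\<in>UNIV. chi4 (z $ j * x $ j + x $ j)) =
      (\<Prod>j\<in>UNIV. \<Sum>c\<in>{0, 1}. chi4 (z $ j * c + c))"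
    by (rule sum_grid_prod) simp
  also have "(\<Sum>x\<in>?G. \<Prod>j\<in>UNIV. chi4 (z $ j * x $ j - x $ j)) =
      (\<Prod>j\<in>UNIV. \<Sum>c\<in>{0, 1}. chi4 (z $ j * c - c))"
    by (rule sum_grid_prod) simp
  finally show ?thesis by (simp add: chi4_simps)
qed

lemma cmod_one_plus_chi4:
  "(cmod (1 + chi4 u))\<^sup>2 = 2 * real (fibre_count 0 0 u)"
  "(cmod (1 + chi4 (u + 1)))\<^sup>2 = 2 * real (fibre_count 1 1 u)"
  "(cmod (1 + chi4 (u - 1)))\<^sup>2 = 2 * real (fibre_count 0 1 u)"
  using Z4_cases[of u]
  by (elim disjE; simp add: fibre_count_simps chi4_simps Z4_reduce cmod_power2)+

lemma cmod_prod_squared: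
  assumes "\<And>j. (cmod (f j))\<^sup>2 = 2 * real (g j)"
  shows "(cmod (\<Prod>j\<in>UNIV. f j))\<^sup>2 = 2 ^ CARD('n) * real (\<Prod>j\<in>(UNIV::'n::finite set). g j)"
proof -
  have "(cmod (\<Prod>j\<in>UNIV. f j))\<^sup>2 = (\<Prod>j\<in>UNIV. 2 * real (g j))"
    by (simp add: prod_norm[symmetric] prod_power_distrib assms)
  then show ?thesis by (simp add: prod.distrib)
qed

text \<open>The only point of the argument at which the parity of the dimension matters.\<close>

lemma prod_shift_cnj_real:
  fixes z :: "4 ^ 'n::finite"
  assumes "even CARD('n)"
  shows "(\<Prod>j\<in>UNIV. 1 + chi4 (z $ j + 1)) * cnj (\<Prod>j\<in>UNIV. 1 + chi4 (z $ j - 1)) \<in> \<real>"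
proof -
  \<comment> \<open>The factor at \<open>u = z_j\<close> is \<open>2 i\<close> for \<open>u = 0\<close>, \<open>-2 i\<close> for \<open>u = 2\<close>, and 0 for odd \<open>u\<close>.\<close>
  define r :: "4 \<Rightarrow> real" where "r u = (if u = 0 then 2 else if u = 2 then -2 else 0)" for u
  have "(1 + chi4 (u + 1)) * cnj (1 + chi4 (u - 1)) = \<i> * of_real (r u)" for u
    using Z4_cases[of u]
    by (elim disjE) (simp_all add: r_def chi4_simps Z4_reduce algebra_simps)
  then have "(\<Prod>j\<in>UNIV. (1 + chi4 (z $ j + 1)) * cnj (1 + chi4 (z $ j - 1))) =
      (\<Prod>j\<in>UNIV. \<i> * of_real (r (z $ j)))"
    by (simp only:)
  then have "(\<Prod>j\<in>UNIV. 1 + chi4 (z $ j + 1)) * cnj (\<Prod>j\<in>UNIV. 1 + chi4 (z $ j - 1)) =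
      \<i> ^ CARD('n) * of_real (\<Prod>j\<in>UNIV. r (z $ j))"
    by (simp add: prod.distrib)
  moreover obtain k where "CARD('n) = 2 * k" using assms by (elim evenE)
  moreover have "\<i> ^ (2 * k) = of_real ((-1) ^ k)" by (simp add: power_mult)
  ultimately show ?thesis by (metis Reals_mult Reals_of_real)
qed

text \<open>The cross term in the squared modulus is the imaginary part of \<open>P * cnj Q\<close>.\<close>

lemma cmod_combination:
  assumes "P * cnj Q \<in> \<real>"
  shows "(cmod (((1 - \<i>) * P + (1 + \<i>) * Q) / 2))\<^sup>2 = ((cmod P)\<^sup>2 + (cmod Q)\<^sup>2) / 2"
proof -
  define a b c d where defs: "a = Re P" "b = Im P" "c = Re Q" "d = Im Q"
  define Z where "Z = ((1 - \<i>) * P + (1 + \<i>) * Q) / 2"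
  have "b * c = a * d"
    using assms by (simp add: complex_is_Real_iff defs)
  then have "(a + b + c - d)\<^sup>2 + (b - a + c + d)\<^sup>2 = 2 * (a\<^sup>2 + b\<^sup>2 + (c\<^sup>2 + d\<^sup>2))"
    by algebra
  moreover have "2 * Re Z = a + b + c - d" "2 * Im Z = b - a + c + d"
    by (simp_all add: Z_def defs)
  ultimately have "4 * ((Re Z)\<^sup>2 + (Im Z)\<^sup>2) = 2 * (a\<^sup>2 + b\<^sup>2 + (c\<^sup>2 + d\<^sup>2))"
    by algebra
  then have "(cmod Z)\<^sup>2 = (a\<^sup>2 + b\<^sup>2 + (c\<^sup>2 + d\<^sup>2)) / 2"
    by (simp add: cmod_power2)
  then show ?thesis
    by (simp add: Z_def defs cmod_power2)
qed

lemma formally_dual_pair_cubes: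
  assumes "even CARD('n)"
  shows "formally_dual_pair canonical_iso lifted_cube (double_cube :: (2 \<times> (4 ^ 'n::finite)) set)"
  unfolding formally_dual_pair_def
proof (intro conjI allI)
  show "dual_iso (canonical_iso :: 2 \<times> (4 ^ 'n) \<Rightarrow> _)" by (rule dual_iso_canonical_iso)
  fix y :: "2 \<times> (4 ^ 'n)"
  obtain w z where y: "y = (w, z)" by fastforce
  have const: "(real (card (lifted_cube :: (2 \<times> (4 ^ 'n)) set)))\<^sup>2 /
      real (card (double_cube :: (2 \<times> (4 ^ 'n)) set)) = 2 ^ CARD('n) / 2"
    by (simp add: card_lifted_cube card_double_cube power2_eq_square)
  have "(cmod (char_eval (canonical_iso (w, z)) (set_sum lifted_cube)))\<^sup>2 =
      2 ^ CARD('n) / 2 * real (diff_count double_cube (w, z))"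
    using Z2_cases[of w]
  proof
    assume w: "w = 0"
    have eq: "fibre_count 1 0 u = fibre_count 0 0 u" for u by (simp add: fibre_count_simps)
    have "(cmod (\<Prod>j\<in>UNIV. 1 + chi4 (z $ j)))\<^sup>2 =
        2 ^ CARD('n) * real (\<Prod>j\<in>UNIV. fibre_count 0 0 (z $ j))"
      by (rule cmod_prod_squared) (rule cmod_one_plus_chi4)
    then show ?thesis
      unfolding w char_eval_lifted_cube_0 diff_count_double_cube eq by simp
  next
    assume w: "w = 1"
    have "(cmod (\<Prod>j\<in>UNIV. 1 + chi4 (z $ j + 1)))\<^sup>2 =
        2 ^ CARD('n) * real (\<Prod>j\<in>UNIV. fibre_count 1 1 (z $ j))"
      by (rule cmod_prod_squared) (rule cmod_one_plus_chi4)
    moreover have "(cmod (\<Prod>j\<in>UNIV. 1 + chi4 (z $ j - 1)))\<^sup>2 =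
        2 ^ CARD('n) * real (\<Prod>j\<in>UNIV. fibre_count 0 1 (z $ j))"
      by (rule cmod_prod_squared) (rule cmod_one_plus_chi4)
    ultimately show ?thesis
      unfolding w char_eval_lifted_cube_1 diff_count_double_cube
        cmod_combination[OF prod_shift_cnj_real[OF assms]]
      by (simp add: algebra_simps)
  qed
  then show "(cmod (char_eval (canonical_iso y) (set_sum lifted_cube)))\<^sup>2 =
      (real (card (lifted_cube :: (2 \<times> (4 ^ 'n)) set)))\<^sup>2 /
      real (card (double_cube :: (2 \<times> (4 ^ 'n)) set)) * real (diff_count double_cube y)"
    unfolding y const .
qed

section \<open>Primitivity\<close>

lemma diff_in_subgroup_of_subset_coset:
  assumes "add_subgroup H" "A \<subseteq> coset g H" "x \<in> A" "y \<in> A"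
  shows "x - y \<in> H"
proof -
  have "x \<in> coset g H" "y \<in> coset g H" using assms by blast+
  then obtain h k where "h \<in> H" "k \<in> H" "x = g + h" "y = g + k"
    by (auto simp: coset_def)
  moreover have "h + (- k) \<in> H"
    using assms(1) \<open>h \<in> H\<close> \<open>k \<in> H\<close> unfolding add_subgroup_def by blast
  ultimately show ?thesis by simp
qed

lemma period_of_union_of_cosets:
  assumes "add_subgroup H" "A = (\<Union>g\<in>X. coset g H)" "h \<in> H" "a \<in> A"
  shows "a + h \<in> A"
proof -
  obtain g k where g: "g \<in> X" "k \<in> H" "a = g + k"
    using assms by (auto simp: coset_def)
  moreover have "k + h \<in> H" using assms(1,3) \<open>k \<in> H\<close> unfolding add_subgroup_def by blast
  ultimately show ?thesis unfolding assms(2) coset_def by (auto simp: add.assoc)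
qed

lemma subgroup_eq_UNIV:
  fixes H :: "(2 \<times> (4 ^ 'n::finite)) set"
  assumes "add_subgroup H" "(1, 0) \<in> H" "\<And>j. (0, axis j 1) \<in> H"
  shows "H = UNIV"
proof -
  have add: "x + y \<in> H" if "x \<in> H" "y \<in> H" for x y
    using assms(1) that by (simp add: add_subgroup_def)
  have zero: "(0, 0) \<in> H" using assms(1) by (simp add: add_subgroup_def zero_prod_def)
  have axis_add: "axis j c + axis j d = (axis j (c + d) :: 4 ^ 'n)" for j c d
    by (simp add: vec_eq_iff axis_def)
  have step: "(0, axis j (c + 1)) \<in> H" if "(0, axis j c) \<in> H" for j c
    using add[OF that assms(3)[of j]] by (simp add: axis_add)
  have axis_0: "axis j 0 = (0 :: 4 ^ 'n)" for j by (simp add: vec_eq_iff axis_def)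
  have axis: "(0, axis j c) \<in> H" for j c
    using Z4_cases[of c] step[of j 1] step[of j 2] assms(3)[of j] zero by (auto simp: axis_0)
  have sum: "(0, \<Sum>j\<in>I. axis j (b $ j)) \<in> H" if "finite I" for I and b :: "4 ^ 'n"
    using that
  proof (induction I rule: finite_induct)
    case empty
    then show ?case using zero by simp
  next
    case (insert i I)
    then show ?case using add[OF axis[of i "b $ i"] insert.IH] by simp
  qed
  have "(a, b) \<in> H" for a b
  proof -
    have "(0, b) \<in> H" using sum[of UNIV b] by (simp flip: vec_eq_sum_axis)
    moreover have "(a, 0) \<in> H" using Z2_cases[of a] zero assms(2) by auto
    ultimately show ?thesis using add[of "(a, 0)" "(0, b)"] by simp
  qed
  then show ?thesis by auto
qed

text \<open>A union of cosets of \<open>H\<close> is invariant under translation by every element of \<open>H\<close>, so it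
  suffices to exclude nonzero periods.\<close>

lemma primitive_subsetI:
  fixes A :: "(2 \<times> (4 ^ 'n::finite)) set"
  assumes gen: "\<And>H. add_subgroup H \<Longrightarrow> (\<And>x y. x \<in> A \<Longrightarrow> y \<in> A \<Longrightarrow> x - y \<in> H) \<Longrightarrow> H = UNIV"
    and per: "\<And>h. (\<And>x. x \<in> A \<Longrightarrow> x + h \<in> A) \<Longrightarrow> h = 0"
  shows "primitive_subset A"
  unfolding primitive_subset_def
proof (intro conjI notI; elim exE conjE)
  fix H g assume "add_subgroup H" "H \<noteq> UNIV" "A \<subseteq> coset g H"
  then show False using gen[of H] diff_in_subgroup_of_subset_coset by blast
next
  fix H X assume H: "add_subgroup H" "H \<noteq> {0}" "A = (\<Union>g\<in>X. coset g H)"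
  have "h = 0" if "h \<in> H" for h
    using per period_of_union_of_cosets[OF H(1,3) that] by blast
  moreover have "0 \<in> H" using H(1) by (simp add: add_subgroup_def)
  ultimately have "H = {0}" by blast
  with H(2) show False by contradiction
qed

lemma fibre_period:
  "c \<in> fibre 0 \<Longrightarrow> 1 + c \<in> fibre 0 \<Longrightarrow> c = 0"
  "c \<in> fibre 1 \<Longrightarrow> 1 + c \<in> fibre 1 \<Longrightarrow> c \<notin> fibre 0"
  using Z4_cases[of c] by (auto simp: fibre_0_mem fibre_1_mem)

lemma mem_double_cube: "(a, x) \<in> double_cube \<longleftrightarrow> (\<forall>j. x $ j \<in> fibre a)"
  by (simp add: double_cube_def grid_def)

lemma primitive_double_cube: "primitive_subset (double_cube :: (2 \<times> (4 ^ 'n::finite)) set)"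
proof (rule primitive_subsetI)
  fix H :: "(2 \<times> (4 ^ 'n)) set"
  assume H: "add_subgroup H" and diff: "\<And>x y. x \<in> double_cube \<Longrightarrow> y \<in> double_cube \<Longrightarrow> x - y \<in> H"
  have zero: "(a, 0) \<in> double_cube" for a
    by (simp add: mem_double_cube zero_in_fibre)
  have "(0, axis j 1) \<in> double_cube" for j
    by (simp add: mem_double_cube axis_def fibre_0_mem)
  from diff[OF this zero[of 0]] diff[OF zero[of 1] zero[of 0]] show "H = UNIV"
    by (intro subgroup_eq_UNIV H) simp_all
next
  fix h :: "2 \<times> (4 ^ 'n)"
  assume per: "\<And>x. x \<in> double_cube \<Longrightarrow> x + h \<in> double_cube"
  obtain c y where h: "h = (c, y)" by fastforce
  have 0: "y $ j \<in> fibre c" for j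
    using per[of "(0, 0)"] by (simp add: h mem_double_cube zero_in_fibre)
  have 1: "1 + y $ j \<in> fibre c" for j
    using per[of "(0, \<chi> j. 1)"] by (simp add: h mem_double_cube fibre_0_mem)
  have 2: "y $ j \<in> fibre (1 + c)" for j
    using per[of "(1, 0)"] by (simp add: h mem_double_cube zero_in_fibre)
  \<comment> \<open>For \<open>c = 1\<close> the first two facts force \<open>y_j = 3\<close>, which the third excludes. Any single
    coordinate will do.\<close>
  have "c \<noteq> 1"
    using 0 1 2 fibre_period(2)[of "y $ undefined"] by (auto simp: Z2_reduce)
  then have "c = 0" using Z2_cases[of c] by blast
  moreover from this have "y = 0" using 0 1 fibre_period(1) by (auto simp: vec_eq_iff)
  ultimately show "h = 0" by (simp add: h zero_prod_def)
qed

lemma mem_lifted_cube: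
  "(a, x) \<in> lifted_cube \<longleftrightarrow> (\<forall>j. x $ j \<in> fibre 0) \<and> a = lift_bit (weight x)"
  by (auto simp: lifted_cube_def grid_def fibre_def)

lemma primitive_lifted_cube:
  assumes "CARD('n) \<ge> 2"
  shows "primitive_subset (lifted_cube :: (2 \<times> (4 ^ 'n::finite)) set)"
proof (rule primitive_subsetI)
  fix H :: "(2 \<times> (4 ^ 'n)) set"
  assume H: "add_subgroup H" and diff: "\<And>x y. x \<in> lifted_cube \<Longrightarrow> y \<in> lifted_cube \<Longrightarrow> x - y \<in> H"
  have zero: "(0, 0) \<in> lifted_cube"
    by (simp add: mem_lifted_cube fibre_0_mem weight_def lift_bit_def)
  have "weight (axis j 1 :: 4 ^ 'n) = 1" for j by (simp add: weight_def axis_def)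
  moreover have "\<forall>i. (axis j 1 :: 4 ^ 'n) $ i \<in> fibre 0" for j
    by (simp add: axis_def fibre_0_mem)
  ultimately have "(0, axis j 1) \<in> (lifted_cube :: (2 \<times> (4 ^ 'n)) set)" for j
    by (simp add: mem_lifted_cube lift_bit_def)
  from diff[OF this zero] have axis: "(0, axis j 1) \<in> H" for j by simp
  have "\<not> is_singleton (UNIV :: 'n set)"
    using assms by (simp add: is_singleton_altdef)
  then obtain j k :: 'n where "j \<noteq> k"
    by (metis UNIV_I UNIV_eq_I is_singletonI insertI1 singletonD singletonI)
  \<comment> \<open>A vector of weight 2 carries the bit 1 and so separates \<open>(1, 0)\<close> from the unit vectors.\<close>
  let ?e = "axis j 1 + axis k 1 :: 4 ^ 'n"
  have "{i. ?e $ i = 1} = {j, k}" using \<open>j \<noteq> k\<close> by (auto simp: axis_def)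
  then have "weight ?e = 2" using \<open>j \<noteq> k\<close> by (simp add: weight_def)
  moreover have "?e $ i \<in> fibre 0" for i
    using \<open>j \<noteq> k\<close> by (simp add: fibre_0_mem axis_def)
  ultimately have "(1, ?e) \<in> lifted_cube"
    by (simp add: mem_lifted_cube lift_bit_def)
  from diff[OF this zero] have "(1, ?e) \<in> H" by simp
  moreover have "- (0, ?e) \<in> H"
  proof -
    have "(0, axis j 1) + (0, axis k 1) \<in> H"
      using H axis unfolding add_subgroup_def by blast
    then have "(0, ?e) \<in> H" by simp
    then show ?thesis using H unfolding add_subgroup_def by blast
  qed
  ultimately have "(1, ?e) + - (0, ?e) \<in> H" using H unfolding add_subgroup_def by blast
  then have "(1, 0) \<in> H" by simp
  then show "H = UNIV" using axis by (intro subgroup_eq_UNIV H)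
next
  fix h :: "2 \<times> (4 ^ 'n)"
  assume per: "\<And>x. x \<in> lifted_cube \<Longrightarrow> x + h \<in> lifted_cube"
  obtain c y where h: "h = (c, y)" by fastforce
  have zero: "(0, 0) \<in> lifted_cube"
    by (simp add: mem_lifted_cube fibre_0_mem weight_def lift_bit_def)
  then have 0: "y $ j \<in> fibre 0" for j
    using per[OF zero] by (simp add: h mem_lifted_cube)
  have "(lift_bit (weight ((\<chi> j. 1) :: 4 ^ 'n)), (\<chi> j. 1) :: 4 ^ 'n) \<in> lifted_cube"
    by (simp add: mem_lifted_cube fibre_0_mem)
  from per[OF this] have 1: "1 + y $ j \<in> fibre 0" for j
    by (simp add: h mem_lifted_cube)
  have "y = 0" using 0 1 fibre_period(1) by (auto simp: vec_eq_iff)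
  moreover have "c = 0"
    using per[OF zero] zero \<open>y = 0\<close> by (simp add: h mem_lifted_cube)
  ultimately show "h = 0" by (simp add: h zero_prod_def)
qed

section \<open>The multiset of difference counts\<close>

lemma replicate_mset_add: "replicate_mset (a + b) x = replicate_mset a x + replicate_mset b x"
  by (rule multiset_eqI) simp

lemma sum_single_UNIV_split:
  fixes f :: "'a::finite \<Rightarrow> 'b"
  assumes "\<And>x. x \<notin> A \<Longrightarrow> f x = c"
  shows "(\<Sum>x\<in>UNIV. {#f x#}) = (\<Sum>x\<in>A. {#f x#}) + replicate_mset (CARD('a) - card A) c"
proof -
  have "(\<Sum>x\<in>UNIV. {#f x#}) = (\<Sum>x\<in>UNIV - A. {#f x#}) + (\<Sum>x\<in>A. {#f x#})"
    by (rule sum.subset_diff) simp_all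
  also have "(\<Sum>x\<in>UNIV - A. {#f x#}) = (\<Sum>x\<in>UNIV - A. {#c#})"
    using assms by (intro sum.cong) auto
  finally show ?thesis
    by (simp add: sum_single_const card_Diff_subset[OF finite subset_UNIV] del: Diff_UNIV)
qed

lemma card_vec4: "CARD(4 ^ 'n::finite) = 4 ^ CARD('n)"
  by simp

lemma diff_counts_0:
  "(\<Sum>x\<in>UNIV. {#int (diff_count (double_cube :: (2 \<times> (4 ^ 'n::finite)) set) (0, x))#}) =
    (\<Sum>k\<le>CARD('n). replicate_mset ((CARD('n) choose k) * 2 ^ (CARD('n) - k)) (2 ^ (k + 1))) +
    replicate_mset (4 ^ CARD('n) - 3 ^ CARD('n)) 0"
proof -
  let ?G = "grid (\<lambda>_::'n. {0} \<union> {1, 3 :: 4})"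
  have "(\<Sum>x\<in>?G. {#int (diff_count (double_cube :: (2 \<times> (4 ^ 'n)) set) (0, x))#}) =
      (\<Sum>x\<in>?G. {#2 ^ (card {j. x $ j \<in> {0}} + 1)#})"
    by (intro sum.cong refl) (simp only: diff_count_double_cube_0 if_True, simp)
  also have "\<dots> = (\<Sum>k\<le>CARD('n). replicate_mset
      ((CARD('n) choose k) * (card {0 :: 4} ^ k * card {1, 3 :: 4} ^ (CARD('n) - k))) (2 ^ (k + 1)))"
    by (rule sum_single_grid_profile) simp
  also have "\<dots> = (\<Sum>k\<le>CARD('n). replicate_mset ((CARD('n) choose k) * 2 ^ (CARD('n) - k)) (2 ^ (k + 1)))"
    by (simp add: numeral_2_eq_2)
  finally have sum_G: "(\<Sum>x\<in>?G. {#int (diff_count (double_cube :: (2 \<times> (4 ^ 'n)) set) (0, x))#}) =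
      (\<Sum>k\<le>CARD('n). replicate_mset ((CARD('n) choose k) * 2 ^ (CARD('n) - k)) (2 ^ (k + 1)))" .
  have "card ?G = 3 ^ CARD('n)" by (simp add: card_grid_const numeral_3_eq_3)
  moreover have "int (diff_count double_cube (0, x)) = 0" if "x \<notin> ?G" for x :: "4 ^ 'n"
    using that by (simp only: diff_count_double_cube_0 if_False of_nat_0)
  then have "(\<Sum>x\<in>UNIV. {#int (diff_count (double_cube :: (2 \<times> (4 ^ 'n)) set) (0, x))#}) =
      (\<Sum>x\<in>?G. {#int (diff_count double_cube (0, x))#}) + replicate_mset (CARD(4 ^ 'n) - card ?G) 0"
    by (rule sum_single_UNIV_split)
  ultimately show ?thesis by (simp only: card_vec4 sum_G)
qed

text \<open>The submultiset \<open>X\<close> collects the nonzero values. Counting each of the two supports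
  separately counts \<open>{0, 2}^n\<close> twice, which adds \<open>2^n\<close> copies of the value 2 to \<open>X\<close>. At \<open>k = 0\<close>
  both products equal 1, so that the value is 2 instead of \<open>2^0\<close>.\<close>

lemma diff_counts_1:
  obtains X :: "int multiset" where
    "(\<Sum>x\<in>UNIV. {#int (diff_count (double_cube :: (2 \<times> (4 ^ 'n::finite)) set) (1, x))#}) =
      X + replicate_mset (4 ^ CARD('n) + 2 ^ CARD('n) - 2 * 3 ^ CARD('n)) 0"
    "X + replicate_mset (2 ^ CARD('n)) 2 =
      (\<Sum>k\<le>CARD('n). replicate_mset (2 * ((CARD('n) choose k) * 2 ^ (CARD('n) - k)))
        (if k = 0 then 2 else 2 ^ k))"
proof
  let ?f = "\<lambda>x. int (diff_count (double_cube :: (2 \<times> (4 ^ 'n)) set) (1, x))"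
  let ?G = "\<lambda>a. grid (\<lambda>_::'n. {a} \<union> {0, 2 :: 4})"
  let ?F = "\<lambda>k. if k = 0 then 2 else 2 ^ k :: int"
  let ?X = "\<Sum>x\<in>?G 1 \<union> ?G 3. {#?f x#}"
  have int_eq: "?G 1 \<inter> ?G 3 = grid (\<lambda>_. {0, 2})"
  proof -
    have "c \<in> {1} \<union> {0, 2} \<and> c \<in> {3} \<union> {0, 2} \<longleftrightarrow> c \<in> {0, 2}" for c :: 4 by auto
    then show ?thesis unfolding grid_def by blast
  qed
  have card_G: "card (?G a) = 3 ^ CARD('n)" if "a \<in> {1, 3}" for a
    using that by (auto simp: card_grid_const numeral_3_eq_3)
  have card_int: "card (?G 1 \<inter> ?G 3) = 2 ^ CARD('n)"
    unfolding int_eq by (simp add: card_grid_const numeral_2_eq_2)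
  have mem_pos: "card {j. x $ j \<in> {a}} > 0 \<longleftrightarrow> x \<notin> ?G b"
    if "x \<in> ?G a" "(a, b) \<in> {(1, 3), (3, 1)}" for x a b
  proof -
    have "x $ j \<in> {a} \<longleftrightarrow> x $ j \<notin> {b} \<union> {0, 2}" for j
    proof -
      have "x $ j \<in> {a} \<union> {0, 2}" using that(1) by (simp add: grid_def)
      with that(2) show ?thesis by auto
    qed
    then have "x \<notin> ?G b \<longleftrightarrow> {j. x $ j \<in> {a}} \<noteq> {}" unfolding grid_def by blast
    then show ?thesis by (simp only: card_gt_0_iff finite simp_thms)
  qed
  have val1: "?f x = ?F (card {j. x $ j \<in> {1}})" if "x \<in> ?G 1" for x
  proof (cases "x \<in> ?G 3")
    case True
    then have "card {j. x $ j \<in> {1}} = 0" "card {j. x $ j \<in> {3}} = 0"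
      using mem_pos[OF that, of 3] mem_pos[OF True, of 1] that by simp_all
    then show ?thesis using that True
      by (simp only: diff_count_double_cube_1 if_True) simp
  next
    case False
    then have "card {j. x $ j \<in> {1}} > 0" using mem_pos[OF that, of 3] by simp
    then obtain k where k: "card {j. x $ j \<in> {1}} = k" "k > 0" by blast
    show ?thesis using that False k(2)
      by (simp only: diff_count_double_cube_1 if_True if_False k(1)) simp
  qed
  have val3: "?f x = ?F (card {j. x $ j \<in> {3}})" if "x \<in> ?G 3" for x
  proof (cases "x \<in> ?G 1")
    case True
    then have "card {j. x $ j \<in> {1}} = 0" "card {j. x $ j \<in> {3}} = 0"
      using mem_pos[OF that, of 1] mem_pos[OF True, of 3] that by simp_all
    then show ?thesis using that True
      by (simp only: diff_count_double_cube_1 if_True) simp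
  next
    case False
    then have "card {j. x $ j \<in> {3}} > 0" using mem_pos[OF that, of 1] by simp
    then obtain k where k: "card {j. x $ j \<in> {3}} = k" "k > 0" by blast
    show ?thesis using that False k(2)
      by (simp only: diff_count_double_cube_1 if_True if_False k(1)) simp
  qed
  have profile: "(\<Sum>x\<in>?G a. {#?F (card {j. x $ j \<in> {a}})#}) =
      (\<Sum>k\<le>CARD('n). replicate_mset ((CARD('n) choose k) * 2 ^ (CARD('n) - k)) (?F k))"
    if "a \<in> {1, 3}" for a
  proof -
    have "(\<Sum>x\<in>?G a. {#?F (card {j. x $ j \<in> {a}})#}) = (\<Sum>k\<le>CARD('n). replicate_mset
        ((CARD('n) choose k) * (card {a} ^ k * card {0, 2 :: 4} ^ (CARD('n) - k))) (?F k))"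
      by (rule sum_single_grid_profile) (use that in auto)
    then show ?thesis by (simp add: numeral_2_eq_2)
  qed
  have "card (?G 1 \<union> ?G 3) + 2 ^ CARD('n) = 2 * 3 ^ CARD('n)"
    using card_Un_Int[of "?G 1" "?G 3"] card_G card_int by simp
  then have "4 ^ CARD('n) - card (?G 1 \<union> ?G 3) = 4 ^ CARD('n) + 2 ^ CARD('n) - 2 * 3 ^ CARD('n)"
    by simp
  moreover have "?f x = 0" if "x \<notin> ?G 1 \<union> ?G 3" for x
    using that unfolding diff_count_double_cube_1
    by (simp only: Un_iff de_Morgan_disj if_False add_0 of_nat_0)
  then have "(\<Sum>x\<in>UNIV. {#?f x#}) = ?X + replicate_mset (CARD(4 ^ 'n) - card (?G 1 \<union> ?G 3)) 0"
    by (rule sum_single_UNIV_split)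
  ultimately show "(\<Sum>x\<in>UNIV. {#?f x#}) =
      ?X + replicate_mset (4 ^ CARD('n) + 2 ^ CARD('n) - 2 * 3 ^ CARD('n)) 0"
    by (simp only: card_vec4)
  have "(\<Sum>x\<in>?G 1 \<inter> ?G 3. {#?f x#}) = (\<Sum>x\<in>?G 1 \<inter> ?G 3. {#2#})"
  proof (intro sum.cong refl)
    fix x assume x: "x \<in> ?G 1 \<inter> ?G 3"
    then have "x \<in> ?G 1" "x \<in> ?G 3" by blast+
    moreover from this have "card {j. x $ j \<in> {1}} = 0" using mem_pos[of x 1 3] by simp
    ultimately have "?f x = 2" using val1[of x] by (simp only: if_True simp_thms)
    then show "{#?f x#} = {#2#}" by (simp only:)
  qed
  then have "?X + replicate_mset (2 ^ CARD('n)) 2 = ?X + (\<Sum>x\<in>?G 1 \<inter> ?G 3. {#?f x#})"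
    by (simp only: sum_single_const finite card_int)
  also have "\<dots> = (\<Sum>x\<in>?G 1. {#?f x#}) + (\<Sum>x\<in>?G 3. {#?f x#})"
    by (rule sum.union_inter) simp_all
  also have "(\<Sum>x\<in>?G 1. {#?f x#}) = (\<Sum>x\<in>?G 1. {#?F (card {j. x $ j \<in> {1}})#})"
    by (intro sum.cong refl) (simp only: val1)
  also have "(\<Sum>x\<in>?G 3. {#?f x#}) = (\<Sum>x\<in>?G 3. {#?F (card {j. x $ j \<in> {3}})#})"
    by (intro sum.cong refl) (simp only: val3)
  finally show "?X + replicate_mset (2 ^ CARD('n)) 2 =
      (\<Sum>k\<le>CARD('n). replicate_mset (2 * ((CARD('n) choose k) * 2 ^ (CARD('n) - k))) (?F k))"
    by (simp only: profile[OF insertI1] profile[OF insertI2[OF singletonI]] mult_2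
        replicate_mset_add sum.distrib)
qed

lemma three_nine_power_le: "m \<ge> 1 \<Longrightarrow> 3 * 9 ^ m \<le> 2 * (16 :: nat) ^ m"
  by (induction m rule: dec_induct) simp_all

lemma two_nine_power_le: "2 * 9 ^ m \<le> (16 :: nat) ^ m + 4 ^ m"
proof (induction m)
  case (Suc m)
  have "(4 :: nat) ^ m \<le> 16 ^ m" by (rule power_mono) simp_all
  with Suc show ?case by simp
qed simp

lemma diff_counts:
  assumes n: "CARD('n::finite) = 2 * m" and m: "m \<ge> 1"
  shows "{#int (diff_count (double_cube :: (2 \<times> (4 ^ 'n)) set) g). g \<in># mset_set UNIV#} =
      replicate_mset (2 ^ (4 * m + 1) - 3 ^ (2 * m + 1) + 2 ^ (2 * m)) 0 +
      replicate_mset ((m + 1) * 2 ^ (2 * m + 1)) 2 +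
      (\<Sum>l\<in>{2..2 * m + 1}.
        replicate_mset (2 ^ (2 * m + 1 - l) * ((2 * m choose (l - 1)) + (2 * m choose l)))
          (2 ^ l))"
proof -
  let ?f = "\<lambda>g. int (diff_count (double_cube :: (2 \<times> (4 ^ 'n)) set) g)"
  \<comment> \<open>\<open>?A l\<close> collects the occurrences of the value \<open>2 ^ l\<close> at points \<open>(0, x)\<close> and, for \<open>l \<ge> 2\<close>,
    \<open>?D l\<close> those at points \<open>(1, x)\<close>.\<close>
  let ?A = "\<lambda>l. replicate_mset (2 ^ (2 * m + 1 - l) * (2 * m choose (l - 1))) (2 ^ l :: int)"
  let ?D = "\<lambda>l. replicate_mset (2 ^ (2 * m + 1 - l) * (2 * m choose l)) (2 ^ l :: int)"
  have "{#?f g. g \<in># mset_set UNIV#} = (\<Sum>g\<in>UNIV. {#?f g#})"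
    by (simp add: sum_unfold_sum_mset)
  also have "\<dots> = (\<Sum>a\<in>UNIV. \<Sum>x\<in>UNIV. {#?f (a, x)#})"
    by (simp add: sum.cartesian_product flip: UNIV_Times_UNIV)
  also have "\<dots> = (\<Sum>x\<in>UNIV. {#?f (0, x)#}) + (\<Sum>x\<in>UNIV. {#?f (1, x)#})"
    by (simp add: UNIV_Z2)
  finally have total: "{#?f g. g \<in># mset_set UNIV#} =
      (\<Sum>x\<in>UNIV. {#?f (0, x)#}) + (\<Sum>x\<in>UNIV. {#?f (1, x)#})" .
  obtain X where X: "(\<Sum>x\<in>UNIV. {#?f (1, x)#}) =
        X + replicate_mset (4 ^ (2 * m) + 2 ^ (2 * m) - 2 * 3 ^ (2 * m)) 0"
      "X + replicate_mset (2 ^ (2 * m)) 2 =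
        (\<Sum>k\<le>2 * m. replicate_mset (2 * ((2 * m choose k) * 2 ^ (2 * m - k)))
          (if k = 0 then 2 else 2 ^ k))"
    using diff_counts_1[where 'n = 'n] unfolding n by blast
  have "(\<Sum>k\<le>2 * m. replicate_mset ((2 * m choose k) * 2 ^ (2 * m - k)) (2 ^ (k + 1))) =
      (\<Sum>k\<le>2 * m. ?A (Suc k))"
    by (simp add: mult.commute)
  also have "\<dots> = (\<Sum>l\<in>{Suc 0..Suc (2 * m)}. ?A l)"
    by (simp only: sum.atLeast1_atMost_eq lessThan_Suc_atMost)
  also have "\<dots> = ?A (Suc 0) + (\<Sum>l\<in>{Suc (Suc 0)..Suc (2 * m)}. ?A l)"
    by (rule sum.atLeast_Suc_atMost) simp
  also have "\<dots> = replicate_mset (2 ^ (2 * m)) 2 + (\<Sum>l\<in>{2..2 * m + 1}. ?A l)"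
    by (simp del: sum.cl_ivl_Suc add: numeral_2_eq_2)
  finally have zero_part: "(\<Sum>x\<in>UNIV. {#?f (0, x)#}) = replicate_mset (2 ^ (2 * m)) 2 +
      (\<Sum>l\<in>{2..2 * m + 1}. ?A l) + replicate_mset (4 ^ (2 * m) - 3 ^ (2 * m)) 0"
    using diff_counts_0[where 'n = 'n] by (simp add: n)
  have "{..2 * m} = {0, 1} \<union> {2..2 * m}" using m by auto
  then have "X + replicate_mset (2 ^ (2 * m)) 2 =
      (\<Sum>k\<in>{0, 1} \<union> {2..2 * m}. replicate_mset (2 * ((2 * m choose k) * 2 ^ (2 * m - k)))
          (if k = 0 then 2 else 2 ^ k))"
    by (simp only: X(2))
  also have "\<dots> = (\<Sum>k\<in>{0, 1}. replicate_mset (2 * ((2 * m choose k) * 2 ^ (2 * m - k)))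
          (if k = 0 then 2 else 2 ^ k)) +
      (\<Sum>k\<in>{2..2 * m}. replicate_mset (2 * ((2 * m choose k) * 2 ^ (2 * m - k)))
          (if k = 0 then 2 else 2 ^ k))"
    by (rule sum.union_disjoint) auto
  also have "(\<Sum>k\<in>{2..2 * m}. replicate_mset (2 * ((2 * m choose k) * 2 ^ (2 * m - k)))
          (if k = 0 then 2 else 2 ^ k)) = (\<Sum>l\<in>{2..2 * m}. ?D l)"
    by (intro sum.cong refl) (simp add: Suc_diff_le mult_ac)
  \<comment> \<open>The term \<open>l = 2 * m + 1\<close> is empty, since the binomial coefficient vanishes.\<close>
  also have "\<dots> = (\<Sum>l\<in>{2..2 * m + 1}. ?D l)"
    using m by simp
  also have "(\<Sum>k\<in>{0, 1}. replicate_mset (2 * ((2 * m choose k) * 2 ^ (2 * m - k)))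
          (if k = 0 then 2 else 2 ^ k)) =
      replicate_mset (2 ^ (2 * m) + m * 2 ^ (2 * m + 1)) 2 + replicate_mset (2 ^ (2 * m)) (2 :: int)"
  proof -
    have "(2 :: nat) ^ (2 * m) = 2 * 2 ^ (2 * m - 1)" using m by (simp flip: power_Suc)
    then show ?thesis by (simp add: mult_ac flip: replicate_mset_add)
  qed
  finally have one_part: "X = replicate_mset (2 ^ (2 * m) + m * 2 ^ (2 * m + 1)) 2 +
      (\<Sum>l\<in>{2..2 * m + 1}. ?D l)"
    by simp
  have two: "(m + 1) * 2 ^ (2 * m + 1) =
      2 ^ (2 * m) + (2 ^ (2 * m) + m * 2 ^ (2 * m + 1))" by simp
  have zero: "2 ^ (4 * m + 1) - 3 ^ (2 * m + 1) + 2 ^ (2 * m) =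
      (4 ^ (2 * m) - 3 ^ (2 * m)) + (4 ^ (2 * m) + 2 ^ (2 * m) - 2 * 3 ^ (2 * m) :: nat)"
  proof -
    \<comment> \<open>The inequalities below ensure that no subtraction of natural numbers is truncated.\<close>
    have "(2 :: nat) ^ (4 * m) = 16 ^ m" "(4 :: nat) ^ (2 * m) = 16 ^ m"
      "(3 :: nat) ^ (2 * m) = 9 ^ m"
      by (simp_all add: power_mult)
    moreover have "(9 :: nat) ^ m \<le> 16 ^ m" by (rule power_mono) simp_all
    moreover have "2 * 9 ^ m \<le> (16 :: nat) ^ m + 2 ^ (2 * m)"
      using two_nine_power_le by (simp add: power_mult)
    ultimately show ?thesis using three_nine_power_le[OF m] by simp
  qed
  have "replicate_mset (2 ^ (2 * m + 1 - l) * ((2 * m choose (l - 1)) + (2 * m choose l)))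
      (2 ^ l) = ?A l + ?D l" for l
    by (simp only: distrib_left replicate_mset_add)
  then show ?thesis
    unfolding total zero_part X(1) one_part zero two
    by (simp only: replicate_mset_add sum.distrib ac_simps)
qed

section \<open>Vectors with prescribed numbers of zeros and ones\<close>

lemma grid_iff_counts:
  fixes x :: "4 ^ 'n::finite"
  assumes "i \<le> CARD('n)"
  shows "card {j. x $ j = 0} = CARD('n) - i \<and> card {j. x $ j = 1} = i \<longleftrightarrow>
    x \<in> grid (\<lambda>_. {0, 1}) \<and> weight x = i"
proof -
  have card_Un: "card ({j. x $ j = 0} \<union> {j. x $ j = 1}) = card {j. x $ j = 0} + card {j. x $ j = 1}"
    by (rule card_Un_disjoint) auto
  have "x \<in> grid (\<lambda>_. {0, 1}) \<longleftrightarrow> {j. x $ j = 0} \<union> {j. x $ j = 1} = UNIV"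
    by (auto simp: grid_def)
  also have "\<dots> \<longleftrightarrow> card {j. x $ j = 0} + card {j. x $ j = 1} = CARD('n)"
    unfolding card_Un[symmetric] using card_eq_UNIV_imp_eq_UNIV by force
  finally show ?thesis using assms by (auto simp: weight_def)
qed

theorem theorem4p2:
  fixes m :: nat
    and J :: "4 set"
    and B :: "nat \<Rightarrow> (4 ^ 'n::finite) set"
    and S T S0 S1 :: "(4 ^ 'n) set"
    and S' T' :: "(2 \<times> (4 ^ 'n)) set"
  assumes "m \<ge> 1" and "CARD('n) = 2 * m"
  defines "J \<equiv> {0, 1}"
  defines "S \<equiv> {x. \<forall>j. x $ j \<in> J}"
  defines "T \<equiv> {x. \<forall>j. x $ j \<in> J}"
  defines "B \<equiv> (\<lambda>i. {x. card {j. x $ j = 0} = 2 * m - i \<and> card {j. x $ j = 1} = i})"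
  defines "S0 \<equiv> (\<Union>i\<in>{i. i \<le> 2 * m \<and> i mod 4 \<in> {0, 1}}. B i)"
  defines "S1 \<equiv> (\<Union>i\<in>{i. i \<le> 2 * m \<and> i mod 4 \<in> {2, 3}}. B i)"
  defines "S' \<equiv> {(0, x) | x. x \<in> S0} \<union> {(1, x) | x. x \<in> S1}"
  defines "T' \<equiv> {(0, x) | x. x \<in> T} \<union> {(1, x) | x. x \<in> uminus ` T}"
  shows "S0 \<union> S1 = S \<and> S0 \<inter> S1 = {} \<and>
    primitive_formally_dual_pair canonical_iso S' T' \<and>
    {# Poly_Mapping.lookup (set_sum T' * ring_inv (set_sum T')) g. g \<in># mset_set UNIV #} =
      replicate_mset (2 ^ (4 * m + 1) - 3 ^ (2 * m + 1) + 2 ^ (2 * m)) 0 +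
      replicate_mset ((m + 1) * 2 ^ (2 * m + 1)) 2 +
      (\<Sum>l\<in>{2..2 * m + 1}.
        replicate_mset (2 ^ (2 * m + 1 - l) * ((2 * m choose (l - 1)) + (2 * m choose l)))
          (2 ^ l))"
proof -
  have S_eq: "S = grid (\<lambda>_. {0, 1})" and T_eq: "T = grid (\<lambda>_. {0, 1})"
    by (simp_all add: S_def T_def J_def grid_def)
  have B_eq: "B i = {x \<in> S. weight x = i}" if "i \<le> 2 * m" for i
    using grid_iff_counts[where 'n = 'n, of i] that assms(2) by (auto simp: B_def S_eq)
  have weight_le: "weight x \<le> 2 * m" for x :: "4 ^ 'n"
    using card_mono[of UNIV "{j. x $ j = 1}"] assms(2) by (simp add: weight_def)
  have S0_eq: "S0 = {x \<in> S. weight x mod 4 \<in> {0, 1}}"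
    using B_eq weight_le by (auto simp: S0_def)
  have S1_eq: "S1 = {x \<in> S. weight x mod 4 \<in> {2, 3}}"
    using B_eq weight_le by (auto simp: S1_def)
  have mod4: "k mod 4 \<in> {2, 3} \<longleftrightarrow> k mod 4 \<notin> {0, 1}" for k :: nat
    by (simp; linarith)
  have S'_eq: "S' = lifted_cube"
  proof (rule set_eqI, clarify)
    fix a :: 2 and x :: "4 ^ 'n"
    have "(a, x) \<in> S' \<longleftrightarrow> a = 0 \<and> x \<in> S0 \<or> a = 1 \<and> x \<in> S1"
      unfolding S'_def by blast
    also have "\<dots> \<longleftrightarrow> x \<in> S \<and> a = lift_bit (weight x)"
      unfolding S0_eq S1_eq mod4 lift_bit_def using Z2_cases[of a] by simp blast
    also have "\<dots> \<longleftrightarrow> (a, x) \<in> lifted_cube"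
      by (simp add: mem_lifted_cube S_eq grid_def fibre_def)
    finally show "(a, x) \<in> S' \<longleftrightarrow> (a, x) \<in> lifted_cube" .
  qed
  have neg_T: "uminus ` T = grid (\<lambda>_. {0, 3})"
  proof (intro equalityI subsetI)
    fix x :: "4 ^ 'n" assume "x \<in> uminus ` T"
    then show "x \<in> grid (\<lambda>_. {0, 3})"
      by (auto simp: T_eq grid_def Z4_reduce)
  next
    fix x :: "4 ^ 'n" assume "x \<in> grid (\<lambda>_. {0, 3})"
    then have "- x \<in> T"
      by (auto simp: T_eq grid_def Z4_reduce)
    then show "x \<in> uminus ` T" by (metis image_eqI minus_minus)
  qed
  have T'_eq: "T' = double_cube"
  proof (rule set_eqI, clarify)
    fix a :: 2 and x :: "4 ^ 'n"
    have "(a, x) \<in> T' \<longleftrightarrow> a = 0 \<and> x \<in> T \<or> a = 1 \<and> x \<in> uminus ` T"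
      unfolding T'_def by blast
    also have "\<dots> \<longleftrightarrow> (a, x) \<in> double_cube"
      unfolding neg_T unfolding T_eq double_cube_def using Z2_cases[of a] by (auto simp: fibre_def)
    finally show "(a, x) \<in> T' \<longleftrightarrow> (a, x) \<in> double_cube" .
  qed
  have "S0 \<union> S1 = S" "S0 \<inter> S1 = {}"
    unfolding S0_eq S1_eq mod4 by auto
  moreover have "primitive_formally_dual_pair canonical_iso S' T'"
    unfolding primitive_formally_dual_pair_def S'_eq T'_eq
    using assms(1,2)
    by (simp add: formally_dual_pair_cubes primitive_lifted_cube primitive_double_cube)
  ultimately show ?thesis
    using diff_counts[OF assms(2,1)] unfolding T'_eq lookup_set_sum_mult_ring_inv by blast
qed

end
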